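(* Let $h:[0,1]\to[0,1]$ be a concave function. For every Borel measurable function $f:[0,1]^n\to\{0,1\}$ there exists a monotone function $g:[0,1]^n\to\{0,1\}$ such that: 1. $\mathbb{E}f=\mathbb{E}g$; 2. for all $1\le k\le n$, $I_f^h(k)\ge I_g^h(k)$.
   Context: $[0,1]^n$ carries the Lebesgue measure $\lambda$, and expectations are with respect to it. A function $g:[0,1]^n\to\mathbb{R}$ is monotone if for all $x,y\in[0,1]^n$, $x_i\ge y_i$ for all $i$ implies $g(x)\ge g(y)$. For $f:[0,1]^n\to\{0,1\}$, $x\in[0,1]^n$ and $1\le k\le n$, let $f_k^x:[0,1]\to\{0,1\}$ be the restriction of $f$ to the fiber through $x$ in direction $k$: $f_k^x(t)=f(x_1,\ldots,x_{k-1},t,x_{k+1},\ldots,x_n)$. For $h:[0,1]\to[0,1]$, the $h$-influence of the $k$-th coordinate on $f$ is $I_f^h(k)=\mathbb{E}_{x\in[0,1]^n}\,h(\mathbb{E}f_k^x)$, where $\mathbb{E}f_k^x=\int_0^1 f_k^x(t)\,dt$. *)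

theory Defs
  imports "HOL-Analysis.Analysis"
begin

definition unit_cube :: "(real ^ 'n) set" where
  "unit_cube = {x. \<forall>i. x $ i \<in> {0..1}}"

(* Expectations use the completed Lebesgue measure: functions that are monotone on the cube
   are Lebesgue measurable but need not be Borel measurable, and over lborel the integral of
   a non-measurable function would be 0 by convention. *)
definition cube_expectation :: "(real ^ 'n \<Rightarrow> real) \<Rightarrow> real" where
  "cube_expectation f = (LINT x|lebesgue_on unit_cube. f x)"

definition fiber :: "(real ^ 'n \<Rightarrow> real) \<Rightarrow> 'n \<Rightarrow> real ^ 'n \<Rightarrow> real \<Rightarrow> real" where
  "fiber f k x t = f (\<chi> i. if i = k then t else x $ i)"

definition fiber_expectation :: "(real ^ 'n \<Rightarrow> real) \<Rightarrow> 'n \<Rightarrow> real ^ 'n \<Rightarrow> real" where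
  "fiber_expectation f k x = (LINT t|lebesgue_on {0..1}. fiber f k x t)"

definition h_influence :: "(real \<Rightarrow> real) \<Rightarrow> (real ^ 'n \<Rightarrow> real) \<Rightarrow> 'n \<Rightarrow> real" where
  "h_influence h f k = cube_expectation (\<lambda>x. h (fiber_expectation f k x))"

end

theory Submission
  imports Defs "HOL-Probability.Probability_Measure"
begin

text \<open>
The function \<open>g\<close> is obtained from \<open>f\<close>, the indicator of a Borel set \<open>A\<close>, by monotone rearrangement
(shifting) in the coordinate directions, one after the other: the shift in direction \<open>k\<close> replaces
each fiber of \<open>A\<close> in that direction by the interval of the same length at the top end of \<open>[0, 1]\<close>. By Fubini
it preserves the measure of \<open>A\<close>, and it makes \<open>A\<close> increasing in direction \<open>k\<close>. A shift in
direction \<open>k\<close> also preserves monotonicity in every other direction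
(\<open>increasing_in_fiber_shift\<close>). Hence one shift per direction yields a set that is increasing in all
directions, and no limit process is needed.

The influence of coordinate \<open>j\<close> is the mean of \<open>h\<close> over the lengths of the \<open>j\<close>-fibers. A shift in
direction \<open>j\<close> leaves these lengths unchanged. A shift in another direction \<open>k\<close> keeps their mean
but makes them more unequal, in the sense of majorization: for each \<open>c\<close>, the mean of the lengths
truncated at \<open>c\<close> does not increase (\<open>truncated_mean_fiber_shift\<close>). This is checked in each plane in
directions \<open>j\<close> and \<open>k\<close>, where it follows from
\<open>measure (F \<inter> B) \<ge> max 0 (measure F + measure B - 1)\<close> for fibers \<open>F\<close> and a suitable set \<open>B\<close>, with
equality for an interval at the top and one at the bottom (\<open>truncated_mean_rearrangement\<close>).
Finally, a concave function is, up to an affine function, a limit of nonnegative combinations of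
truncations \<open>u \<mapsto> min u c\<close>, so smaller truncated means together with equal means give a smaller mean of \<open>h\<close>
(\<open>expectation_concave_mono\<close>). Since the truncated means compose over successive shifts, this step is
done only once, for the first and the last set.
\<close>

section \<open>Concave functions and truncated means\<close>

text \<open>The piecewise linear interpolant of \<open>h\<close> at the points \<open>i / m\<close>: the factor
\<open>m * (min u ((i + 1) / m) - min u (i / m))\<close> is the fraction of the cell \<open>[i / m, (i + 1) / m]\<close>
that lies to the left of \<open>u\<close>. Written in this way it is a linear combination of the truncations
\<open>min u c\<close>, so its expectation is determined by truncated means.\<close>

definition chord_interpolant :: "(real \<Rightarrow> real) \<Rightarrow> nat \<Rightarrow> real \<Rightarrow> real" where
  "chord_interpolant h m u =
     h 0 + (\<Sum>i<m. (h ((real i + 1) / m) - h (real i / m)) *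
              (m * (min u ((real i + 1) / m) - min u (real i / m))))"

lemma chord_interpolant_on_cell:
  assumes m: "0 < m" and j: "j < m" and u: "real j / m \<le> u" "u \<le> (real j + 1) / m"
  shows "chord_interpolant h m u =
           h (real j / m) + (h ((real j + 1) / m) - h (real j / m)) * (m * u - j)"
proof -
  let ?t = "\<lambda>i. (h ((real i + 1) / m) - h (real i / m)) *
              (m * (min u ((real i + 1) / m) - min u (real i / m)))"
  have full: "?t i = h (real (Suc i) / m) - h (real i / m)" if "i < j" for i
  proof -
    have "(real i + 1) / m \<le> real j / m" using m that by (intro divide_right_mono) auto
    moreover have "real i / m \<le> (real i + 1) / m" by (intro divide_right_mono) auto
    ultimately have "min u ((real i + 1) / m) = (real i + 1) / m" "min u (real i / m) = real i / m"
      using u by linarith+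
    then show ?thesis using m by (simp add: field_simps)
  qed
  have none: "?t i = 0" if "i \<ge> Suc j" for i
  proof -
    have "(real j + 1) / m \<le> real i / m" using m that by (intro divide_right_mono) auto
    moreover have "real i / m \<le> (real i + 1) / m" by (intro divide_right_mono) auto
    ultimately have "min u ((real i + 1) / m) = u" "min u (real i / m) = u"
      using u by linarith+
    then show ?thesis by simp
  qed
  have "(\<Sum>i<m. ?t i) = (\<Sum>i<Suc j. ?t i)"
    using j none by (intro sum.mono_neutral_right) auto
  also have "\<dots> = (\<Sum>i<j. h (real (Suc i) / m) - h (real i / m)) + ?t j"
    using full by simp
  also have "(\<Sum>i<j. h (real (Suc i) / m) - h (real i / m)) = h (real j / m) - h 0"
    using sum_lessThan_telescope[of "\<lambda>i. h (real i / m)" j] by simp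
  also have "?t j = (h ((real j + 1) / m) - h (real j / m)) * (m * u - j)"
  proof -
    have "min u ((real j + 1) / m) = u" "min u (real j / m) = real j / m"
      using u by auto
    then show ?thesis using m by (simp add: algebra_simps)
  qed
  finally show ?thesis unfolding chord_interpolant_def by simp
qed

lemma grid_cell_exists:
  fixes u :: real
  assumes m: "0 < (m::nat)" and u: "u \<in> {0..1}"
  obtains j :: nat where "j < m" "real j / m \<le> u" "u \<le> (real j + 1) / m"
proof (cases "u = 1")
  case True
  show ?thesis using m True by (intro that[of "m - 1"]) (auto simp: of_nat_diff)
next
  case False
  define j where "j = nat \<lfloor>m * u\<rfloor>"
  have j: "real j \<le> m * u" "m * u < real j + 1"
    using u unfolding j_def by (auto simp: floor_less_iff)
  have "real m * u < real m * 1" using u False m by (intro mult_strict_left_mono) auto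
  then have "j < m" using j by linarith
  then show ?thesis using j m by (intro that[of j]) (auto simp: field_simps)
qed

lemma chord_interpolant_between:
  assumes m: "0 < m" and u: "u \<in> {0..1}"
  obtains v w \<theta> where "v \<in> {0..1}" "w \<in> {0..1}" "\<theta> \<in> {0..1}" "\<bar>v - u\<bar> \<le> 1 / m" "\<bar>w - u\<bar> \<le> 1 / m"
    "chord_interpolant h m u = (1 - \<theta>) * h v + \<theta> * h w"
proof -
  obtain j :: nat where j: "j < m" "real j / m \<le> u" "u \<le> (real j + 1) / m"
    using grid_cell_exists[OF assms] .
  have eq: "(real j + 1) / m = real j / m + 1 / m" by (simp add: add_divide_distrib)
  show ?thesis
  proof (rule that[of "real j / m" "(real j + 1) / m" "m * u - j"])
    show "real j / m \<in> {0..1}" "(real j + 1) / m \<in> {0..1}" using j(1) by auto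
    show "m * u - j \<in> {0..1}" using j m by (auto simp: field_simps)
    show "\<bar>real j / m - u\<bar> \<le> 1 / m" "\<bar>(real j + 1) / m - u\<bar> \<le> 1 / m" using j eq by linarith+
    show "chord_interpolant h m u =
        (1 - (m * u - j)) * h (real j / m) + (m * u - j) * h ((real j + 1) / m)"
      using chord_interpolant_on_cell[OF m j] by (simp add: algebra_simps)
  qed
qed

lemma chord_interpolant_bounds:
  assumes m: "0 < m" and u: "u \<in> {0..1}" and h: "h \<in> {0..1} \<rightarrow> {0..1}"
  shows "chord_interpolant h m u \<in> {0..1}"
proof -
  obtain v w \<theta> where *: "v \<in> {0..1}" "w \<in> {0..1}" "\<theta> \<in> {0..1}"
    "chord_interpolant h m u = (1 - \<theta>) * h v + \<theta> * h w"
    using chord_interpolant_between[OF m u] by metis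
  have hv: "h v \<in> {0..1}" "h w \<in> {0..1}" using h * by auto
  have "(1 - \<theta>) * h v + \<theta> * h w \<le> 1"
    using convex_bound_le[of "h v" 1 "h w" "1 - \<theta>" \<theta>] hv * by auto
  then show ?thesis using hv * by auto
qed

text \<open>A concave function is continuous in the interior of its domain, but it may jump at the endpoints
of \<open>[0, 1]\<close>. The endpoints are grid points, and there the interpolant is exact, so convergence
is pointwise on the whole closed interval.\<close>

lemma chord_interpolant_tendsto:
  fixes h :: "real \<Rightarrow> real"
  assumes conc: "concave_on {0..1} h" and u: "u \<in> {0..1}"
  shows "(\<lambda>m. chord_interpolant h (Suc m) u) \<longlonglongrightarrow> h u"
proof -
  consider "u = 0" | "u = 1" | "u \<in> {0<..<1}" using u by force
  then show ?thesis
  proof cases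
    case 1
    have "chord_interpolant h (Suc m) u = h u" for m
      using chord_interpolant_on_cell[of "Suc m" 0 u h] 1 by simp
    then show ?thesis by simp
  next
    case 2
    have "chord_interpolant h (Suc m) u = h u" for m
      using chord_interpolant_on_cell[of "Suc m" m u h] 2
      by (simp add: algebra_simps)
    then show ?thesis by simp
  next
    case 3
    have "convex_on {0<..<1} (\<lambda>x. - h x)"
      using conc unfolding concave_on_def by (rule convex_on_subset) auto
    then have "continuous_on {0<..<1} (\<lambda>x. - h x)"
      by (intro convex_on_continuous) auto
    then have "continuous_on {0<..<1} (\<lambda>x. - (- h x))"
      by (rule continuous_on_minus)
    then have cont: "isCont h u" using 3 by (simp add: continuous_on_eq_continuous_at)
    show ?thesis
    proof (rule LIMSEQ_I)
      fix e :: real assume e: "e > 0"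
      then have "e / 2 > 0" by simp
      then obtain d where d: "d > 0" "\<And>v. \<bar>v - u\<bar> < d \<Longrightarrow> \<bar>h v - h u\<bar> < e / 2"
        using cont unfolding continuous_at_eps_delta dist_real_def by metis
      obtain N where N: "inverse (real (Suc N)) < d" using reals_Archimedean[OF d(1)] by blast
      show "\<exists>no. \<forall>m\<ge>no. norm (chord_interpolant h (Suc m) u - h u) < e"
      proof (intro exI[of _ N] allI impI)
        fix m assume m: "m \<ge> N"
        have "1 / real (Suc m) \<le> inverse (real (Suc N))" using m by (simp add: field_simps)
        then have small: "1 / real (Suc m) < d" using N by linarith
        obtain v w \<theta> where *: "\<theta> \<in> {0..1}" "\<bar>v - u\<bar> \<le> 1 / Suc m" "\<bar>w - u\<bar> \<le> 1 / Suc m"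
          "chord_interpolant h (Suc m) u = (1 - \<theta>) * h v + \<theta> * h w"
          using chord_interpolant_between[of "Suc m" u h] u by (metis zero_less_Suc)
        have close: "\<bar>h v - h u\<bar> \<le> e / 2" "\<bar>h w - h u\<bar> \<le> e / 2"
          using d(2) * small by (meson less_imp_le order_le_less_trans)+
        have "chord_interpolant h (Suc m) u - h u = (1 - \<theta>) * (h v - h u) + \<theta> * (h w - h u)"
          unfolding * by (simp add: algebra_simps)
        also have "\<bar>\<dots>\<bar> \<le> (1 - \<theta>) * \<bar>h v - h u\<bar> + \<theta> * \<bar>h w - h u\<bar>"
          using * abs_triangle_ineq[of "(1 - \<theta>) * (h v - h u)" "\<theta> * (h w - h u)"]
          by (simp add: abs_mult)
        also have "\<dots> \<le> e / 2"
          using convex_bound_le[of "\<bar>h v - h u\<bar>" "e / 2" "\<bar>h w - h u\<bar>" "1 - \<theta>" \<theta>] close * by auto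
        finally show "norm (chord_interpolant h (Suc m) u - h u) < e" using e by simp
      qed
    qed
  qed
qed

lemma borel_measurable_chord_interpolant:
  assumes [measurable]: "Z \<in> borel_measurable M"
  shows "(\<lambda>\<omega>. chord_interpolant h m (Z \<omega>)) \<in> borel_measurable M"
  unfolding chord_interpolant_def by measurable

text \<open>Measurability comes for free from the interpolants, as a pointwise limit.\<close>

lemma borel_measurable_concave_comp:
  fixes h :: "real \<Rightarrow> real"
  assumes "concave_on {0..1} h" and "Z \<in> borel_measurable M" and "Z \<in> space M \<rightarrow> {0..1}"
  shows "(\<lambda>\<omega>. h (Z \<omega>)) \<in> borel_measurable M"
proof (rule borel_measurable_LIMSEQ_real)
  show "(\<lambda>m. chord_interpolant h (Suc m) (Z \<omega>)) \<longlonglongrightarrow> h (Z \<omega>)" if "\<omega> \<in> space M" for \<omega>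
    using assms that by (intro chord_interpolant_tendsto) auto
qed (intro borel_measurable_chord_interpolant assms(2))

text \<open>Summation by parts. It turns the increments \<open>D (i + 1) - D i\<close>, whose signs are unknown, into
the differences \<open>d i - d (i + 1)\<close>, which are nonnegative for a concave function.\<close>

lemma abel_decreasing_slopes:
  fixes d D :: "nat \<Rightarrow> real"
  assumes "\<And>i. i < k \<Longrightarrow> d (Suc i) \<le> d i" and "\<And>i. D i \<ge> 0" and "D 0 = 0"
  shows "(\<Sum>i<Suc k. d i * (D (Suc i) - D i)) \<ge> d k * D (Suc k)"
  using assms(1)
proof (induction k)
  case (Suc k)
  have "d (Suc k) * D (Suc k) \<le> d k * D (Suc k)"
    using Suc.prems assms(2) by (intro mult_right_mono) auto
  moreover have "(\<Sum>i<Suc k. d i * (D (Suc i) - D i)) \<ge> d k * D (Suc k)"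
    using Suc by auto
  ultimately show ?case by (simp add: right_diff_distrib)
qed (simp add: assms(3))

lemma concave_grid_slopes_decrease:
  assumes conc: "concave_on {0..1} h" and i: "Suc i < m"
  shows "h ((real (Suc i) + 1) / m) - h (real (Suc i) / m) \<le> h ((real i + 1) / m) - h (real i / m)"
proof -
  have "h ((1 - 1/2) *\<^sub>R (real i / m) + (1/2) *\<^sub>R ((real i + 2) / m))
      \<ge> (1 - 1/2) * h (real i / m) + (1/2) * h ((real i + 2) / m)"
    using i by (intro concave_onD[OF conc]) auto
  moreover have "(1 - 1/2) *\<^sub>R (real i / m) + (1/2) *\<^sub>R ((real i + 2) / m) = (real i + 1) / m"
    using i by (simp add: field_simps)
  moreover have "real (Suc i) = real i + 1" "real (Suc i) + 1 = real i + 2" by auto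
  ultimately show ?thesis by (simp add: add.commute)
qed

text \<open>This is the integral form of the majorization inequality of Hardy, Littlewood and Polya. For a
chord interpolant of \<open>h\<close> the difference of the two expectations is
\<open>\<Sum>i. d i * (D (i + 1) - D i)\<close>, where the slopes \<open>d\<close> decrease and \<open>D i\<close> is the difference of
the means truncated at \<open>i / m\<close>. The \<open>D i\<close> are nonnegative and vanish at both ends of the grid (at the
right end because the means agree), so summation by parts shows that the sum is nonnegative.
Dominated convergence passes to \<open>h\<close>.\<close>

lemma expectation_concave_mono:
  fixes X Y :: "'a \<Rightarrow> real"
  assumes "prob_space M"
    and [measurable]: "X \<in> borel_measurable M" "Y \<in> borel_measurable M"
    and X: "X \<in> space M \<rightarrow> {0..1}" and Y: "Y \<in> space M \<rightarrow> {0..1}"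
    and trunc: "\<And>c. c \<in> {0..1} \<Longrightarrow> (LINT \<omega>|M. min (Y \<omega>) c) \<le> (LINT \<omega>|M. min (X \<omega>) c)"
    and mean: "(LINT \<omega>|M. X \<omega>) = (LINT \<omega>|M. Y \<omega>)"
    and h: "h \<in> {0..1} \<rightarrow> {0..1}" and conc: "concave_on {0..1} h"
  shows "(LINT \<omega>|M. h (Y \<omega>)) \<le> (LINT \<omega>|M. h (X \<omega>))"
proof -
  interpret prob_space M by fact
  define T where "T Z c = (LINT \<omega>|M. min (Z \<omega>) c)" for Z :: "'a \<Rightarrow> real" and c
  have int_min: "integrable M (\<lambda>\<omega>. min (Z \<omega>) c)"
    if [measurable]: "Z \<in> borel_measurable M" and "Z \<in> space M \<rightarrow> {0..1}" for Z :: "'a \<Rightarrow> real" and c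
    using that(2) by (intro integrable_const_bound[where B = "1 + \<bar>c\<bar>"]) (auto intro!: AE_I2 simp: Pi_iff min_def)
  have expand: "(LINT \<omega>|M. chord_interpolant h m (Z \<omega>)) =
      h 0 + (\<Sum>i<m. (h ((real i + 1) / m) - h (real i / m)) *
                      (m * (T Z ((real i + 1) / m) - T Z (real i / m))))"
    if Z: "Z \<in> borel_measurable M" "Z \<in> space M \<rightarrow> {0..1}" for Z m
    unfolding chord_interpolant_def T_def using int_min[OF Z]
    by (simp add: prob_space)
  have lim: "(\<lambda>m. LINT \<omega>|M. chord_interpolant h (Suc m) (Z \<omega>)) \<longlonglongrightarrow> (LINT \<omega>|M. h (Z \<omega>))"
    if [measurable]: "Z \<in> borel_measurable M" and Z: "Z \<in> space M \<rightarrow> {0..1}" for Z :: "'a \<Rightarrow> real"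
  proof (rule integral_dominated_convergence[where w = "\<lambda>_. 1"])
    show "(\<lambda>\<omega>. chord_interpolant h (Suc m) (Z \<omega>)) \<in> borel_measurable M" for m
      using that(1) by (rule borel_measurable_chord_interpolant)
    show "(\<lambda>\<omega>. h (Z \<omega>)) \<in> borel_measurable M"
      using conc that by (rule borel_measurable_concave_comp)
    show "AE \<omega> in M. (\<lambda>m. chord_interpolant h (Suc m) (Z \<omega>)) \<longlonglongrightarrow> h (Z \<omega>)"
      using Z by (intro AE_I2 chord_interpolant_tendsto[OF conc]) auto
    show "AE \<omega> in M. norm (chord_interpolant h (Suc m) (Z \<omega>)) \<le> 1" for m
    proof (rule AE_I2)
      fix \<omega> assume "\<omega> \<in> space M"
      then have "chord_interpolant h (Suc m) (Z \<omega>) \<in> {0..1}"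
        using Z h by (intro chord_interpolant_bounds) auto
      then show "norm (chord_interpolant h (Suc m) (Z \<omega>)) \<le> 1" by auto
    qed
  qed auto
  have "(LINT \<omega>|M. chord_interpolant h (Suc m) (Y \<omega>)) \<le> (LINT \<omega>|M. chord_interpolant h (Suc m) (X \<omega>))" for m
  proof -
    let ?n = "real (Suc m)"
    define d where "d i = ?n * (h ((real i + 1) / ?n) - h (real i / ?n))" for i
    \<comment> \<open>The cap at 1 makes \<open>D i \<ge> 0\<close> hold for every \<open>i\<close>, also beyond the grid.\<close>
    define D where "D i = T X (min 1 (real i / ?n)) - T Y (min 1 (real i / ?n))" for i
    have nonneg: "D i \<ge> 0" for i using trunc[of "min 1 (real i / ?n)"] unfolding D_def T_def by simp
    have "T Z 0 = 0" if "Z \<in> space M \<rightarrow> {0..1}" for Z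
    proof -
      have "T Z 0 = (LINT \<omega>|M. 0)" unfolding T_def
        using that by (intro Bochner_Integration.integral_cong) (auto simp: Pi_iff)
      then show ?thesis by simp
    qed
    then have D0: "D 0 = 0" unfolding D_def using X Y by simp
    have "T Z 1 = (LINT \<omega>|M. Z \<omega>)" if "Z \<in> space M \<rightarrow> {0..1}" for Z
      unfolding T_def using that by (intro Bochner_Integration.integral_cong) (auto simp: Pi_iff)
    then have D1: "D (Suc m) = 0" unfolding D_def using X Y mean by simp
    have "d (Suc i) \<le> d i" if "i < m" for i
      unfolding d_def using that by (intro mult_left_mono concave_grid_slopes_decrease[OF conc]) auto
    then have "0 \<le> (\<Sum>i<Suc m. d i * (D (Suc i) - D i))"
      using abel_decreasing_slopes[of m d D] nonneg D0 D1 by auto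
    also have "\<dots> = (\<Sum>i<Suc m. (h ((real i + 1) / ?n) - h (real i / ?n)) *
          (?n * (T X ((real i + 1) / ?n) - T X (real i / ?n)))
        - (h ((real i + 1) / ?n) - h (real i / ?n)) *
          (?n * (T Y ((real i + 1) / ?n) - T Y (real i / ?n))))"
    proof (rule sum.cong)
      fix i assume "i \<in> {..<Suc m}"
      then have "real (Suc i) / ?n = (real i + 1) / ?n" "(real i + 1) / ?n \<le> 1" "real i / ?n \<le> 1"
        by (auto simp: divide_le_eq_1 simp del: of_nat_Suc)
      then have "min 1 (real (Suc i) / ?n) = (real i + 1) / ?n" "min 1 (real i / ?n) = real i / ?n"
        by linarith+
      then have D: "D (Suc i) = T X ((real i + 1) / ?n) - T Y ((real i + 1) / ?n)"
        "D i = T X (real i / ?n) - T Y (real i / ?n)"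
        unfolding D_def by simp_all
      show "d i * (D (Suc i) - D i) = (h ((real i + 1) / ?n) - h (real i / ?n)) *
          (?n * (T X ((real i + 1) / ?n) - T X (real i / ?n)))
        - (h ((real i + 1) / ?n) - h (real i / ?n)) *
          (?n * (T Y ((real i + 1) / ?n) - T Y (real i / ?n)))"
        unfolding D d_def by (simp only: algebra_simps)
    qed simp
    also have "\<dots> = (LINT \<omega>|M. chord_interpolant h (Suc m) (X \<omega>)) - (LINT \<omega>|M. chord_interpolant h (Suc m) (Y \<omega>))"
      using expand[of X "Suc m"] expand[of Y "Suc m"] X Y by (simp only: sum_subtractf assms(2,3))
    finally show ?thesis by simp
  qed
  then show ?thesis
    using lim[of X] lim[of Y] X Y by (intro LIMSEQ_le[where X = "\<lambda>m. LINT \<omega>|M. chord_interpolant h (Suc m) (Y \<omega>)"]) auto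
qed

section \<open>Rearranging the fibers of a set in a plane\<close>

definition unit_interval_measure :: "real measure" where
  "unit_interval_measure = restrict_space lborel {0..1}"

lemma space_unit_interval_measure [simp]: "space unit_interval_measure = {0..1}"
  by (simp add: unit_interval_measure_def space_restrict_space)

lemma prob_space_unit_interval_measure: "prob_space unit_interval_measure"
  unfolding unit_interval_measure_def by (rule prob_spaceI) (simp add: space_restrict_space emeasure_restrict_space)

lemma measurable_unit_interval_measure:
  "f \<in> borel \<rightarrow>\<^sub>M N \<Longrightarrow> f \<in> unit_interval_measure \<rightarrow>\<^sub>M N"
  unfolding unit_interval_measure_def by (rule measurable_restrict_space1) simp

lemma measure_unit_interval_measure_Icc:
  assumes "0 \<le> a" "b \<le> 1"
  shows "measure unit_interval_measure {t\<in>{0..1}. a \<le> t \<and> t \<le> b} = max 0 (b - a)"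
proof -
  have "{t\<in>{0..1}. a \<le> t \<and> t \<le> b} = {a..b}" using assms by auto
  then show ?thesis
    unfolding unit_interval_measure_def using assms
    by (subst measure_restrict_space) auto
qed

lemma (in pair_sigma_finite) measurable_measure_section:
  assumes "A \<in> sets (M1 \<Otimes>\<^sub>M M2)"
  shows "(\<lambda>s. measure M2 {t\<in>space M2. (s, t) \<in> A}) \<in> borel_measurable M1"
    and "(\<lambda>t. measure M1 {s\<in>space M1. (s, t) \<in> A}) \<in> borel_measurable M2"
proof -
  have "A \<subseteq> space M1 \<times> space M2"
    using sets.sets_into_space[OF assms] by (simp add: space_pair_measure)
  then have eq: "{t\<in>space M2. (s, t) \<in> A} = Pair s -` A"
    "{s\<in>space M1. (s, t) \<in> A} = (\<lambda>s. (s, t)) -` A" for s t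
    by auto
  show "(\<lambda>s. measure M2 {t\<in>space M2. (s, t) \<in> A}) \<in> borel_measurable M1"
    unfolding eq measure_def
    by (intro borel_measurable_enn2real measurable_emeasure_Pair1 assms)
  show "(\<lambda>t. measure M1 {s\<in>space M1. (s, t) \<in> A}) \<in> borel_measurable M2"
    unfolding eq measure_def
    by (intro borel_measurable_enn2real measurable_emeasure_Pair2 assms)
qed

text \<open>The two-dimensional heart of the argument. The set \<open>A\<close> lies over the base \<open>M\<close>, with
vertical fibers of length \<open>\<phi> s\<close>, and the rearranged set has the top interval \<open>[1 - \<phi> s, 1]\<close> above each
\<open>s\<close>. The claim concerns the measures \<open>\<psi>\<close> and \<open>\<psi>'\<close> of the horizontal slices before and after.

Let \<open>B\<close> be the set of heights where \<open>\<psi> t \<le> c\<close>, and \<open>b\<close> its measure. Then the mean of \<open>min \<psi> c\<close>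
is exactly \<open>c * (1 - b)\<close> plus the part of \<open>A\<close> at heights in \<open>B\<close>. The fiber over \<open>s\<close> meets \<open>B\<close> in
measure at least \<open>max 0 (\<phi> s + b - 1)\<close>, which is the length of the intersection of the
rearranged fiber with \<open>[0, b]\<close>. Hence the part of \<open>A\<close> at heights in \<open>B\<close> is at least the part of
the rearranged set at heights in \<open>[0, b]\<close>, and the latter plus \<open>c * (1 - b)\<close> bounds the mean of
\<open>min \<psi>' c\<close>, since \<open>min \<psi>' c\<close> is at most \<open>\<psi>'\<close> on \<open>[0, b]\<close> and at most \<open>c\<close> elsewhere.\<close>

lemma truncated_mean_rearrangement:
  fixes M :: "'s measure" and A :: "('s \<times> real) set"
  defines "U \<equiv> unit_interval_measure"
  assumes "prob_space M" and A[measurable]: "A \<in> sets (M \<Otimes>\<^sub>M U)"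
  defines "\<phi> \<equiv> \<lambda>s. measure U {t\<in>space U. (s, t) \<in> A}"
  shows "(LINT t|U. min (measure M {s\<in>space M. 1 - \<phi> s \<le> t}) c)
           \<le> (LINT t|U. min (measure M {s\<in>space M. (s, t) \<in> A}) c)"
proof -
  interpret M: prob_space M by fact
  interpret U: prob_space U unfolding U_def by (rule prob_space_unit_interval_measure)
  interpret pair_prob_space M U ..
  have spU: "space U = {0..1}" by (simp add: U_def)
  have idU[measurable]: "(\<lambda>t. t) \<in> borel_measurable U" unfolding U_def by (rule measurable_unit_interval_measure) simp
  have [measurable]: "\<phi> \<in> borel_measurable M"
    unfolding \<phi>_def using A by (rule measurable_measure_section)
  define Q where "Q = {p\<in>space (M \<Otimes>\<^sub>M U). 1 - \<phi> (fst p) \<le> snd p}"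
  have Q[measurable]: "Q \<in> sets (M \<Otimes>\<^sub>M U)" unfolding Q_def by measurable
  define \<psi> where "\<psi> t = measure M {s\<in>space M. (s, t) \<in> A}" for t
  define \<psi>' where "\<psi>' t = measure M {s\<in>space M. (s, t) \<in> Q}" for t
  have Q_sec: "measure M {s\<in>space M. 1 - \<phi> s \<le> t} = \<psi>' t" if "t \<in> space U" for t
    unfolding \<psi>'_def using that by (intro arg_cong[where f = "measure M"]) (auto simp: Q_def space_pair_measure)
  have \<psi>_meas[measurable]: "\<psi> \<in> borel_measurable U"
    unfolding \<psi>_def using A by (rule measurable_measure_section)
  have \<psi>'_meas[measurable]: "\<psi>' \<in> borel_measurable U"
    unfolding \<psi>'_def using Q by (rule measurable_measure_section)
  have bnd: "0 \<le> \<psi> t" "\<psi> t \<le> 1" "0 \<le> \<psi>' t" "\<psi>' t \<le> 1" for t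
    unfolding \<psi>_def \<psi>'_def by auto
  have \<phi>_bnd: "0 \<le> \<phi> s" "\<phi> s \<le> 1" for s unfolding \<phi>_def by auto
  define B where "B = {t\<in>space U. \<psi> t \<le> c}"
  have [measurable]: "B \<in> sets U" unfolding B_def by measurable
  define b where "b = measure U B"
  have b: "0 \<le> b" "b \<le> 1" unfolding b_def by auto
  have int: "integrable U f" if [measurable]: "f \<in> borel_measurable U" and "\<And>t. \<bar>f t\<bar> \<le> C" for f :: "real \<Rightarrow> real" and C
    using that(2) by (intro U.integrable_const_bound[where B = C]) auto
  \<comment> \<open>The part of a set at heights in \<open>S\<close> can be measured by horizontal slices or by vertical fibers.\<close>
  have swap: "(LINT t|U. indicator S t * measure M {s\<in>space M. (s, t) \<in> Q})
        = (LINT s|M. measure U {t\<in>space U. t \<in> S \<and> (s, t) \<in> Q})"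
    if [measurable]: "S \<in> sets U" "Q \<in> sets (M \<Otimes>\<^sub>M U)" for S Q
  proof -
    define F :: "'s \<Rightarrow> real \<Rightarrow> real" where "F s t = indicator S t * indicator Q (s, t)" for s t
    have F[measurable]: "case_prod F \<in> borel_measurable (M \<Otimes>\<^sub>M U)"
      unfolding F_def by measurable
    have "integrable (M \<Otimes>\<^sub>M U) (case_prod F)"
      by (rule P.integrable_const_bound[where B = 1]) (auto simp: F_def indicator_def)
    then have "(LINT t|U. LINT s|M. F s t) = (LINT s|M. LINT t|U. F s t)" by (rule Fubini_integral)
    moreover have "(LINT s|M. F s t) = indicator S t * measure M {s\<in>space M. (s, t) \<in> Q}" if "t \<in> space U" for t
    proof -
      have "(LINT s|M. F s t) = indicator S t * (LINT s|M. indicator {s\<in>space M. (s, t) \<in> Q} s)"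
        unfolding F_def by (subst integral_mult_right_zero, intro arg_cong2[where f="(*)"] Bochner_Integration.integral_cong) (auto simp: indicator_def)
      moreover have "{s\<in>space M. (s, t) \<in> Q} \<in> sets M" using that by measurable
      ultimately show ?thesis by simp
    qed
    moreover have "(LINT t|U. F s t) = measure U {t\<in>space U. t \<in> S \<and> (s, t) \<in> Q}" if "s \<in> space M" for s
    proof -
      have "(LINT t|U. F s t) = (LINT t|U. indicator {t\<in>space U. t \<in> S \<and> (s, t) \<in> Q} t)"
        unfolding F_def by (intro Bochner_Integration.integral_cong) (auto simp: indicator_def)
      moreover have "{t\<in>space U. t \<in> S \<and> (s, t) \<in> Q} \<in> sets U" using that by measurable
      ultimately show ?thesis by simp
    qed
    ultimately show ?thesis by (metis (mono_tags, lifting) Bochner_Integration.integral_cong)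
  qed
  \<comment> \<open>The lowest heights, in the same amount as there are in \<open>B\<close>.\<close>
  define S where "S = {t\<in>space U. t \<le> b}"
  have [measurable]: "S \<in> sets U" unfolding S_def by measurable
  have S: "measure U S = b"
  proof -
    have "S = {t\<in>{0..1}. 0 \<le> t \<and> t \<le> b}" unfolding S_def spU by auto
    then have "measure U S = max 0 (b - 0)"
      unfolding U_def using b by (simp only:) (rule measure_unit_interval_measure_Icc, auto)
    then show ?thesis using b by simp
  qed
  have split: "(LINT t|U. indicator E t * Z t + c * indicator (space U - E) t)
      = (LINT t|U. indicator E t * Z t) + c * (1 - measure U E)"
    if [measurable]: "E \<in> sets U" "Z \<in> borel_measurable U" and Z: "\<And>t. 0 \<le> Z t" "\<And>t. Z t \<le> 1" for E and Z :: "real \<Rightarrow> real"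
  proof -
    have "integrable U (\<lambda>t. indicator E t * Z t)" 
      using Z by (intro int[of _ 1]) (auto simp: indicator_def)
    moreover have "integrable U (\<lambda>t. c * indicator (space U - E) t)"
      by (intro int[of _ "\<bar>c\<bar>"]) (auto simp: indicator_def)
    ultimately show ?thesis by (simp add: U.prob_compl)
  qed
  have "(LINT t|U. min (\<psi>' t) c) \<le> (LINT t|U. indicator S t * \<psi>' t + c * indicator (space U - S) t)"
  proof (rule integral_mono)
    have "\<bar>min (\<psi>' t) c\<bar> \<le> 1 + \<bar>c\<bar>" for t
      using bnd(3,4)[of t] by (auto simp: min_def abs_if)
    then show "integrable U (\<lambda>t. min (\<psi>' t) c)"
      by (intro int borel_measurable_min \<psi>'_meas borel_measurable_const)
    have "\<bar>indicator S t * \<psi>' t\<bar> \<le> 1" for t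
      using bnd by (auto simp: indicator_def)
    then have i1: "integrable U (\<lambda>t. indicator S t * \<psi>' t)" by (intro int) auto
    have "\<bar>c * indicator (space U - S) t\<bar> \<le> \<bar>c\<bar>" for t
      by (auto simp: indicator_def)
    then have i2: "integrable U (\<lambda>t. c * indicator (space U - S) t)" by (intro int) auto
    show "integrable U (\<lambda>t. indicator S t * \<psi>' t + c * indicator (space U - S) t)"
      using i1 i2 by (rule Bochner_Integration.integrable_add)
  next
    fix t assume "t \<in> space U"
    then show "min (\<psi>' t) c \<le> indicator S t * \<psi>' t + c * indicator (space U - S) t"
      by (cases "t \<in> S") auto
  qed
  also have "\<dots> = (LINT t|U. indicator S t * \<psi>' t) + c * (1 - b)"
    using split[of S \<psi>'] bnd S by simp
  also have "(LINT t|U. indicator S t * \<psi>' t) = (LINT s|M. measure U {t\<in>space U. t \<in> S \<and> (s, t) \<in> Q})"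
    unfolding \<psi>'_def by (rule swap) auto
  also have "\<dots> \<le> (LINT s|M. measure U {t\<in>space U. t \<in> B \<and> (s, t) \<in> A})"
  proof (rule integral_mono)
    have "(\<lambda>s. measure U {t\<in>space U. t \<in> B' \<and> (s, t) \<in> A'}) \<in> borel_measurable M"
      if [measurable]: "B' \<in> sets U" "A' \<in> sets (M \<Otimes>\<^sub>M U)" for B' A'
    proof -
      have "space M \<times> B' \<inter> A' \<in> sets (M \<Otimes>\<^sub>M U)" by measurable
      then show ?thesis
        using measurable_measure_section(1)[of "space M \<times> B' \<inter> A'"]
        by (rule_tac measurable_cong[THEN iffD1, rotated]) auto
    qed
    then show "integrable M (\<lambda>s. measure U {t\<in>space U. t \<in> S \<and> (s, t) \<in> Q})"
      "integrable M (\<lambda>s. measure U {t\<in>space U. t \<in> B \<and> (s, t) \<in> A})"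
      by (intro M.integrable_const_bound[where B = 1]; auto)+
  next
    fix s assume s: "s \<in> space M"
    have "{t\<in>space U. t \<in> S \<and> (s, t) \<in> Q} = {t\<in>{0..1}. 1 - \<phi> s \<le> t \<and> t \<le> b}"
      using s by (auto simp: Q_def S_def space_pair_measure spU)
    then have "measure U {t\<in>space U. t \<in> S \<and> (s, t) \<in> Q} = max 0 (\<phi> s + b - 1)"
      using measure_unit_interval_measure_Icc[of "1 - \<phi> s" b] \<phi>_bnd b unfolding U_def by (simp add: algebra_simps)
    also have "\<dots> \<le> measure U {t\<in>space U. t \<in> B \<and> (s, t) \<in> A}"
    proof -
      let ?A = "{t\<in>space U. (s, t) \<in> A}"
      have [measurable]: "?A \<in> sets U" using s by measurable
      have "measure U (?A \<union> B) = measure U ?A + measure U B - measure U (?A \<inter> B)"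
        by (intro measure_Un3) (auto simp: fmeasurable_def less_top[symmetric])
      moreover have "measure U (?A \<union> B) \<le> 1" by (rule U.prob_le_1)
      moreover have "?A \<inter> B = {t\<in>space U. t \<in> B \<and> (s, t) \<in> A}" by auto
      ultimately show ?thesis unfolding \<phi>_def b_def by simp
    qed
    finally show "measure U {t\<in>space U. t \<in> S \<and> (s, t) \<in> Q} \<le> measure U {t\<in>space U. t \<in> B \<and> (s, t) \<in> A}" .
  qed
  also have "\<dots> = (LINT t|U. indicator B t * \<psi> t)"
    unfolding \<psi>_def by (rule swap[symmetric]) auto
  also have "(LINT t|U. indicator B t * \<psi> t) + c * (1 - b)
      = (LINT t|U. indicator B t * \<psi> t + c * indicator (space U - B) t)"
    using split[of B \<psi>] bnd unfolding b_def by simp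
  also have "\<dots> = (LINT t|U. min (\<psi> t) c)"
    by (intro Bochner_Integration.integral_cong) (auto simp: B_def indicator_def min_def)
  finally show ?thesis
    using Q_sec unfolding \<psi>_def by (simp cong: Bochner_Integration.integral_cong)
qed

section \<open>Resampling one coordinate of a uniform point in the cube\<close>

definition cube_measure :: "(real ^ 'n) measure" where
  "cube_measure = restrict_space lborel unit_cube"

definition coord_update :: "real ^ 'n \<Rightarrow> 'n \<Rightarrow> real \<Rightarrow> real ^ 'n" where
  "coord_update x k t = (\<chi> i. if i = k then t else x $ i)"

lemma coord_update_nth [simp]: "coord_update x k t $ i = (if i = k then t else x $ i)"
  by (simp add: coord_update_def)

lemma coord_update_same [simp]: "coord_update (coord_update x k s) k t = coord_update x k t"
  by (simp add: vec_eq_iff)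

lemma coord_update_commute:
  "j \<noteq> k \<Longrightarrow> coord_update (coord_update x k t) j s = coord_update (coord_update x j s) k t"
  by (simp add: vec_eq_iff)

lemma coord_update_in_cube [simp]:
  "x \<in> unit_cube \<Longrightarrow> t \<in> {0..1} \<Longrightarrow> coord_update x k t \<in> unit_cube"
  by (simp add: unit_cube_def)

lemma measurable_coord_update:
  "(\<lambda>(x, t). coord_update x k t) \<in> borel \<Otimes>\<^sub>M borel \<rightarrow>\<^sub>M borel"
proof -
  have "continuous_on UNIV (\<lambda>(x, t). coord_update x k t :: real ^ 'a)"
    unfolding coord_update_def case_prod_beta
  proof (intro continuous_on_vec_lambda)
    fix i show "continuous_on UNIV (\<lambda>p :: (real ^ 'a) \<times> real. if i = k then snd p else fst p $ i)"
      by (cases "i = k") (auto intro!: continuous_intros)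
  qed
  then show ?thesis
    unfolding borel_prod by (rule borel_measurable_continuous_onI)
qed

lemma measurable_coord_update_lborel:
  "(\<lambda>(x, t). coord_update x k t) \<in> lborel \<Otimes>\<^sub>M lborel \<rightarrow>\<^sub>M borel"
  by (subst measurable_cong_sets[OF sets_pair_measure_cong[OF sets_lborel sets_lborel] refl])
    (rule measurable_coord_update)

lemma unit_cube_eq_cbox: "unit_cube = cbox 0 (1 :: real ^ 'n)"
  by (auto simp: unit_cube_def mem_box_cart)

lemma unit_cube_borel [measurable]: "unit_cube \<in> sets borel"
  by (simp add: unit_cube_eq_cbox)

lemma space_cube_measure [simp]: "space cube_measure = unit_cube"
  by (simp add: cube_measure_def space_restrict_space)

lemma measurable_cube_measure: "F \<in> borel \<rightarrow>\<^sub>M N \<Longrightarrow> F \<in> cube_measure \<rightarrow>\<^sub>M N"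
  unfolding cube_measure_def by (rule measurable_restrict_space1) simp

lemma measurable_coord_update_cube:
  "(\<lambda>(x, t). coord_update x k t) \<in> cube_measure \<Otimes>\<^sub>M unit_interval_measure \<rightarrow>\<^sub>M borel"
proof -
  have f_id: "(\<lambda>p. (fst p, snd p)) \<in> (cube_measure :: (real ^ 'a) measure) \<Otimes>\<^sub>M unit_interval_measure
      \<rightarrow>\<^sub>M borel \<Otimes>\<^sub>M borel"
    by (intro measurable_Pair measurable_compose[OF measurable_fst] measurable_compose[OF measurable_snd]
        measurable_cube_measure measurable_unit_interval_measure) auto
  then show ?thesis
    using measurable_compose[OF f_id measurable_coord_update] by (simp add: case_prod_beta)
qed

lemma prod_Basis_cart:
  fixes g :: "real ^ 'n \<Rightarrow> real"
  shows "(\<Prod>b\<in>Basis. g b) = (\<Prod>i\<in>UNIV. g (axis i 1))"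
proof -
  have "Basis = (\<lambda>i. axis i (1::real)) ` (UNIV :: 'n set)" by (auto simp: Basis_vec_def)
  moreover have "inj (\<lambda>i :: 'n. axis i (1::real))" by (auto intro: injI simp: axis_eq_axis)
  ultimately show ?thesis using prod.reindex[of "\<lambda>i :: 'n. axis i (1::real)" UNIV g] by (simp add: o_def)
qed

lemma emeasure_lborel_box_cart:
  fixes l u :: "real ^ 'n"
  assumes "\<And>i. l $ i \<le> u $ i"
  shows "emeasure lborel (box l u) = (\<Prod>i\<in>UNIV. u $ i - l $ i)"
    and "emeasure lborel (cbox l u) = (\<Prod>i\<in>UNIV. u $ i - l $ i)"
proof -
  have "\<forall>b\<in>Basis. l \<bullet> b \<le> u \<bullet> b" using assms by (auto simp: Basis_vec_def inner_axis)
  moreover have "(\<Prod>b\<in>Basis. (u - l) \<bullet> b) = (\<Prod>i\<in>UNIV. u $ i - l $ i)"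
    by (simp only: prod_Basis_cart) (simp add: inner_axis)
  ultimately show "emeasure lborel (box l u) = (\<Prod>i\<in>UNIV. u $ i - l $ i)"
    and "emeasure lborel (cbox l u) = (\<Prod>i\<in>UNIV. u $ i - l $ i)"
    by (simp_all add: emeasure_lborel_box_eq emeasure_lborel_cbox_eq)
qed

lemma prob_space_cube_measure: "prob_space (cube_measure :: (real ^ 'n) measure)"
proof (rule prob_spaceI)
  show "emeasure cube_measure (space (cube_measure :: (real ^ 'n) measure)) = 1"
    unfolding cube_measure_def space_restrict_space
    using emeasure_lborel_box_cart(2)[of "0 :: real ^ 'n" 1]
    by (simp add: emeasure_restrict_space unit_cube_eq_cbox)
qed

lemma coordinate_slab_sets:
  "{(x :: real ^ 'n, t :: real). x $ k \<in> {0..1}} \<in> sets (lborel \<Otimes>\<^sub>M lborel)"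
proof -
  have "{x :: real ^ 'n. x $ k \<in> {0..1}} \<in> sets borel" by measurable
  then have "{x :: real ^ 'n. x $ k \<in> {0..1}} \<times> UNIV \<in> sets (lborel \<Otimes>\<^sub>M (lborel :: real measure))"
    by (intro pair_measureI) auto
  also have "{x :: real ^ 'n. x $ k \<in> {0..1}} \<times> UNIV = {(x, t). x $ k \<in> {0..1}}" by auto
  finally show ?thesis .
qed

text \<open>Replacing one coordinate that is uniform on \<open>[0, 1]\<close> by an independent one that is
distributed as \<open>lborel\<close> gives back Lebesgue measure. It suffices to check boxes, for which both sides
are products of side lengths; the old coordinate contributes the factor 1. This replaces an
identification of \<open>real ^ 'n\<close> with a product of a line and a space of one dimension less.\<close>

lemma lborel_resample_coordinate:
  fixes k :: "'n::finite"
  shows "lborel = distr (restrict_space (lborel \<Otimes>\<^sub>M lborel) {(x, t). x $ k \<in> {0..1}}) borel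
                    (\<lambda>(x :: real ^ 'n, t). coord_update x k t)"
    (is "lborel = distr ?R borel ?f")
proof (rule lborel_eqI)
  have slab: "{(x :: real ^ 'n, t :: real). x $ k \<in> {0..1}} \<in> sets (lborel \<Otimes>\<^sub>M lborel)"
    by (rule coordinate_slab_sets)
  have f: "?f \<in> ?R \<rightarrow>\<^sub>M borel"
    by (intro measurable_restrict_space1 measurable_coord_update_lborel)
  fix l u :: "real ^ 'n"
  assume "\<And>b. b \<in> Basis \<Longrightarrow> l \<bullet> b \<le> u \<bullet> b"
  then have lu: "l $ i \<le> u $ i" for i by (metis axis_in_Basis_iff Basis_real_def cart_eq_inner_axis singletonI)
  define X where "X = {x :: real ^ 'n. x $ k \<in> {0..1} \<and> (\<forall>i. i \<noteq> k \<longrightarrow> l $ i < x $ i \<and> x $ i < u $ i)}"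
  let ?l = "coord_update l k 0" and ?u = "coord_update u k 1"
  have [measurable]: "X \<in> sets borel" unfolding X_def by measurable
  \<comment> \<open>\<open>X\<close> is closed in direction \<open>k\<close> and open in the others; it lies between an open and a closed box of equal volume.\<close>
  have "emeasure lborel X = (\<Prod>i\<in>UNIV. ?u $ i - ?l $ i)"
  proof (rule antisym)
    have "X \<subseteq> cbox ?l ?u" unfolding X_def by (auto simp: mem_box_cart less_imp_le)
    then have "emeasure lborel X \<le> emeasure lborel (cbox ?l ?u)" by (intro emeasure_mono) auto
    then show "emeasure lborel X \<le> (\<Prod>i\<in>UNIV. ?u $ i - ?l $ i)"
      using lu by (subst (asm) emeasure_lborel_box_cart) auto
    have "box ?l ?u \<subseteq> X"
    proof
      fix x assume "x \<in> box ?l ?u"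
      then have x: "?l $ i < x $ i" "x $ i < ?u $ i" for i by (auto simp only: mem_box_cart)
      show "x \<in> X" unfolding X_def using x[of k] x by (auto dest!: spec) (smt (verit) coord_update_nth)+
    qed
    then have "emeasure lborel (box ?l ?u) \<le> emeasure lborel X" by (intro emeasure_mono) auto
    then show "(\<Prod>i\<in>UNIV. ?u $ i - ?l $ i) \<le> emeasure lborel X"
      using lu by (subst (asm) emeasure_lborel_box_cart) auto
  qed
  also have "(\<Prod>i\<in>UNIV. ?u $ i - ?l $ i) = (\<Prod>i\<in>UNIV - {k}. u $ i - l $ i)"
    by (subst prod.remove[of _ k]) (auto intro!: prod.cong)
  finally have X: "emeasure lborel X = (\<Prod>i\<in>UNIV - {k}. u $ i - l $ i)" .
  have "emeasure (distr ?R borel ?f) (box l u) = emeasure ?R (?f -` box l u \<inter> space ?R)"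
    using f by (subst emeasure_distr) auto
  also have "?f -` box l u \<inter> space ?R = X \<times> {l $ k<..<u $ k}"
    by (auto simp: space_restrict_space space_pair_measure X_def mem_box_cart split: if_splits)
  also have "emeasure ?R (X \<times> {l $ k<..<u $ k}) = emeasure (lborel \<Otimes>\<^sub>M lborel) (X \<times> {l $ k<..<u $ k})"
    using slab by (intro emeasure_restrict_space) (auto simp: X_def space_pair_measure)
  also have "\<dots> = emeasure lborel X * emeasure lborel {l $ k<..<u $ k}"
    by (rule lborel.emeasure_pair_measure_Times) auto
  also have "\<dots> = ennreal ((\<Prod>i\<in>UNIV - {k}. u $ i - l $ i) * (u $ k - l $ k))"
    unfolding X using lu by (simp add: ennreal_mult' prod_nonneg)
  also have "(\<Prod>i\<in>UNIV - {k}. u $ i - l $ i) * (u $ k - l $ k) = (\<Prod>i\<in>UNIV. u $ i - l $ i)"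
    by (subst prod.remove[of UNIV k]) auto
  also have "\<dots> = (\<Prod>b\<in>Basis. (u - l) \<bullet> b)"
    by (simp add: prod_Basis_cart inner_axis)
  finally show "emeasure (distr ?R borel ?f) (box l u) = (\<Prod>b\<in>Basis. (u - l) \<bullet> b)" .
qed simp

text \<open>If a resampled point lies in the cube and its old coordinate is in \<open>[0, 1]\<close>, then the old point and
the new coordinate are in the cube and in the unit interval as well. So the previous lemma restricts
to the cube without loss.\<close>

lemma cube_resample_coordinate:
  fixes k :: "'n::finite"
  shows "distr (cube_measure \<Otimes>\<^sub>M unit_interval_measure) borel (\<lambda>(x :: real ^ 'n, t). coord_update x k t)
       = distr cube_measure borel (\<lambda>x. x)"
    (is "distr ?P borel ?f = _")
proof (rule measure_eqI)
  interpret U: prob_space unit_interval_measure by (rule prob_space_unit_interval_measure)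
  have f: "?f \<in> ?P \<rightarrow>\<^sub>M borel" by (rule measurable_coord_update_cube)
  have slab: "{(x :: real ^ 'n, t :: real). x $ k \<in> {0..1}} \<in> sets (lborel \<Otimes>\<^sub>M lborel)"
    by (rule coordinate_slab_sets)
  have fL: "?f \<in> lborel \<Otimes>\<^sub>M lborel \<rightarrow>\<^sub>M borel"
    by (rule measurable_coord_update_lborel)
  fix X :: "(real ^ 'n) set" assume "X \<in> sets (distr ?P borel ?f)"
  then have X: "X \<in> sets borel" by simp
  let ?X = "X \<inter> unit_cube"
  let ?S = "{p. fst p \<in> unit_cube \<and> snd p \<in> {0..1} \<and> ?f p \<in> X} :: ((real ^ 'n) \<times> real) set"
  have [measurable]: "?X \<in> sets borel" using X by auto
  have S: "?S = {p. fst p $ k \<in> {0..1} \<and> ?f p \<in> ?X}"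
    by (auto simp: unit_cube_def split: if_splits)
  have "?f -` ?X \<inter> space (lborel \<Otimes>\<^sub>M lborel) \<in> sets (lborel \<Otimes>\<^sub>M lborel)"
    by (rule measurable_sets[OF fL]) simp
  then have "{(x, t). x $ k \<in> {0..1}} \<inter> (?f -` ?X \<inter> space (lborel \<Otimes>\<^sub>M lborel)) \<in> sets (lborel \<Otimes>\<^sub>M lborel)"
    using slab by blast
  also have "{(x, t). x $ k \<in> {0..1}} \<inter> (?f -` ?X \<inter> space (lborel \<Otimes>\<^sub>M lborel)) = ?S"
    unfolding S by (auto simp: space_pair_measure)
  finally have S_sets: "?S \<in> sets (lborel \<Otimes>\<^sub>M lborel)" .
  have "(\<lambda>x :: real ^ 'n. x) \<in> cube_measure \<rightarrow>\<^sub>M borel" by (rule measurable_cube_measure) simp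
  then have "emeasure (distr cube_measure borel (\<lambda>x. x)) X = emeasure cube_measure ?X"
    using X by (simp add: emeasure_distr)
  also have "\<dots> = emeasure lborel ?X"
    unfolding cube_measure_def by (rule emeasure_restrict_space) auto
  also have "\<dots> = emeasure (restrict_space (lborel \<Otimes>\<^sub>M lborel) {(x, t). x $ k \<in> {0..1}})
      (?f -` ?X \<inter> space (restrict_space (lborel \<Otimes>\<^sub>M lborel) {(x, t). x $ k \<in> {0..1}}))"
    using fL by (subst lborel_resample_coordinate[of k], subst emeasure_distr)
      (auto intro: measurable_restrict_space1)
  also have "?f -` ?X \<inter> space (restrict_space (lborel \<Otimes>\<^sub>M lborel) {(x, t). x $ k \<in> {0..1}}) = ?S"
    unfolding S by (auto simp: space_restrict_space space_pair_measure)
  also have "emeasure (restrict_space (lborel \<Otimes>\<^sub>M lborel) {(x, t). x $ k \<in> {0..1}}) ?S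
      = emeasure (lborel \<Otimes>\<^sub>M lborel) ?S"
    using slab by (intro emeasure_restrict_space) (auto simp: space_pair_measure unit_cube_def)
  also have "\<dots> = (\<integral>\<^sup>+x. emeasure lborel (Pair x -` ?S) \<partial>lborel)"
    using S_sets by (rule lborel.emeasure_pair_measure_alt)
  also have "\<dots> = (\<integral>\<^sup>+x. emeasure lborel (Pair x -` ?S) * indicator unit_cube x \<partial>lborel)"
    by (intro nn_integral_cong) (auto simp: indicator_def vimage_def)
  also have "\<dots> = (\<integral>\<^sup>+x. emeasure lborel (Pair x -` ?S) \<partial>cube_measure)"
    unfolding cube_measure_def by (subst nn_integral_restrict_space) auto
  also have "\<dots> = (\<integral>\<^sup>+x. emeasure unit_interval_measure (Pair x -` ?S) \<partial>cube_measure)"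
    unfolding unit_interval_measure_def
    by (intro nn_integral_cong, subst emeasure_restrict_space) auto
  also have "\<dots> = emeasure ?P (?f -` X \<inter> space ?P)"
  proof -
    have "?f -` X \<inter> space ?P = ?S" by (auto simp: space_pair_measure)
    moreover have "?f -` X \<inter> space ?P \<in> sets ?P" using f X by (rule measurable_sets)
    ultimately show ?thesis by (simp add: U.emeasure_pair_measure_alt)
  qed
  also have "\<dots> = emeasure (distr ?P borel ?f) X"
    using f X by (simp add: emeasure_distr)
  finally show "emeasure (distr ?P borel ?f) X = emeasure (distr cube_measure borel (\<lambda>x. x)) X" by simp
qed simp

text \<open>Fubini on the cube in direction \<open>k\<close>: an integral does not change when the integrand is first averaged
over the fibers in that direction.\<close>

lemma integral_cube_resample_coordinate:
  fixes F :: "real ^ 'n \<Rightarrow> real"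
  assumes F: "F \<in> borel_measurable borel" and bound: "\<And>x. \<bar>F x\<bar> \<le> K"
  shows "(LINT x|cube_measure. F x) = (LINT x|cube_measure. LINT t|unit_interval_measure. F (coord_update x k t))"
proof -
  interpret C: prob_space "cube_measure :: (real ^ 'n) measure" by (rule prob_space_cube_measure)
  interpret U: prob_space unit_interval_measure by (rule prob_space_unit_interval_measure)
  interpret pair_prob_space "cube_measure :: (real ^ 'n) measure" unit_interval_measure ..
  let ?P = "(cube_measure :: (real ^ 'n) measure) \<Otimes>\<^sub>M unit_interval_measure"
  let ?f = "\<lambda>(x :: real ^ 'n, t). coord_update x k t"
  have f: "?f \<in> ?P \<rightarrow>\<^sub>M borel" by (rule measurable_coord_update_cube)
  have Ff: "(\<lambda>p. F (?f p)) \<in> borel_measurable ?P" using measurable_compose[OF f F] .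
  have "(LINT x|cube_measure. F x) = (LINT x|distr cube_measure borel (\<lambda>x. x). F x)"
    using F by (subst integral_distr) (auto intro: measurable_cube_measure)
  also have "\<dots> = (LINT x|distr ?P borel ?f. F x)"
    by (simp only: cube_resample_coordinate)
  also have "\<dots> = (LINT p|?P. F (?f p))"
    using f F by (rule integral_distr)
  also have "\<dots> = (LINT x|cube_measure. LINT t|unit_interval_measure. F (?f (x, t)))"
    by (rule integral_fst'[symmetric], rule P.integrable_const_bound[where B = K]) (use bound Ff in auto)
  finally show ?thesis by simp
qed

section \<open>Shifting a set in a coordinate direction\<close>

definition fiber_length :: "(real ^ 'n) set \<Rightarrow> 'n \<Rightarrow> real ^ 'n \<Rightarrow> real" where
  "fiber_length A k x = measure unit_interval_measure {t\<in>{0..1}. coord_update x k t \<in> A}"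

text \<open>Every fiber in direction \<open>k\<close> is replaced by the interval of the same length at the top end. The
interval is closed, so a fiber of length 0 becomes the point with \<open>k\<close>-th coordinate 1; no
integral sees these points.\<close>

definition fiber_shift :: "(real ^ 'n) set \<Rightarrow> 'n \<Rightarrow> (real ^ 'n) set" where
  "fiber_shift A k = {x\<in>unit_cube. 1 - fiber_length A k x \<le> x $ k}"

lemma fiber_length_bounds: "0 \<le> fiber_length A k x" "fiber_length A k x \<le> 1"
proof -
  interpret prob_space unit_interval_measure by (rule prob_space_unit_interval_measure)
  show "0 \<le> fiber_length A k x" "fiber_length A k x \<le> 1" unfolding fiber_length_def by auto
qed

lemma fiber_length_update [simp]: "fiber_length A k (coord_update x k t) = fiber_length A k x"
  unfolding fiber_length_def by simp

lemma measurable_coord_update_snd: "coord_update x k \<in> borel \<rightarrow>\<^sub>M borel"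
proof -
  have "(\<lambda>t. (x, t)) \<in> borel \<rightarrow>\<^sub>M borel \<Otimes>\<^sub>M borel" by (intro measurable_Pair) auto
  from measurable_compose[OF this measurable_coord_update] show ?thesis by simp
qed

lemma fiber_sets:
  assumes "A \<in> sets borel"
  shows "{t\<in>{0..1}. coord_update x k t \<in> A} \<in> sets unit_interval_measure"
proof -
  have "(\<lambda>t. coord_update x k t) -` A \<inter> space unit_interval_measure \<in> sets unit_interval_measure"
    by (rule measurable_sets[OF measurable_unit_interval_measure[OF measurable_coord_update_snd] assms])
  moreover have "(\<lambda>t. coord_update x k t) -` A \<inter> space unit_interval_measure = {t\<in>{0..1}. coord_update x k t \<in> A}"
    by auto
  ultimately show ?thesis by simp
qed

lemma integral_indicator_fiber:
  assumes "A \<in> sets borel"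
  shows "(LINT t|unit_interval_measure. indicator {t\<in>{0..1}. coord_update x k t \<in> A} t) = fiber_length A k x"
proof -
  have "{t\<in>{0..1}. coord_update x k t \<in> A} \<inter> space unit_interval_measure = {t\<in>{0..1}. coord_update x k t \<in> A}"
    by auto
  then show ?thesis
    unfolding fiber_length_def Bochner_Integration.integral_indicator by (simp only:)
qed

lemma fiber_length_eq_integral:
  assumes "A \<in> sets borel"
  shows "fiber_length A k x = (LINT t|unit_interval_measure. indicator A (coord_update x k t))"
proof -
  have "(LINT t|unit_interval_measure. indicator A (coord_update x k t) :: real)
      = (LINT t|unit_interval_measure. indicator {t\<in>{0..1}. coord_update x k t \<in> A} t)"
    by (intro Bochner_Integration.integral_cong) (auto simp: indicator_def)
  then show ?thesis using integral_indicator_fiber[OF assms] by simp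
qed

lemma measurable_fiber_length:
  assumes "A \<in> sets borel"
  shows "fiber_length A k \<in> borel_measurable borel"
proof -
  interpret U: prob_space unit_interval_measure by (rule prob_space_unit_interval_measure)
  interpret pair_sigma_finite "lborel :: (real ^ 'a) measure" unit_interval_measure ..
  let ?P = "(lborel :: (real ^ 'a) measure) \<Otimes>\<^sub>M unit_interval_measure"
  have f_id: "(\<lambda>p. (fst p, snd p)) \<in> ?P \<rightarrow>\<^sub>M borel \<Otimes>\<^sub>M borel"
    by (intro measurable_Pair measurable_compose[OF measurable_fst] measurable_compose[OF measurable_snd]
         measurable_unit_interval_measure) auto
  then have f: "(\<lambda>(x, t). coord_update x k t) \<in> ?P \<rightarrow>\<^sub>M borel"
    using measurable_compose[OF f_id measurable_coord_update] by (simp add: case_prod_beta)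
  have "(\<lambda>(x, t). coord_update x k t) -` A \<inter> space ?P \<in> sets ?P"
    using f assms by (rule measurable_sets)
  from measurable_measure_section(1)[OF this]
  have "(\<lambda>s. measure unit_interval_measure {t \<in> space unit_interval_measure.
     (s, t) \<in> (\<lambda>(x, t). coord_update x k t) -` A \<inter> space ?P}) \<in> borel_measurable borel" by simp
  also have "(\<lambda>s. measure unit_interval_measure {t \<in> space unit_interval_measure.
     (s, t) \<in> (\<lambda>(x, t). coord_update x k t) -` A \<inter> space ?P}) = fiber_length A k"
    unfolding fiber_length_def by (intro ext arg_cong[where f = "measure _"]) (auto simp: space_pair_measure)
  finally show ?thesis .
qed

lemma fiber_shift_borel:
  assumes "A \<in> sets borel"
  shows "fiber_shift A k \<in> sets borel"
proof -
  have [measurable]: "fiber_length A k \<in> borel_measurable borel"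
    using assms by (rule measurable_fiber_length)
  have "fiber_shift A k = unit_cube \<inter> {x \<in> space borel. 1 - fiber_length A k x \<le> x $ k}"
    unfolding fiber_shift_def by auto
  also have "\<dots> \<in> sets borel" by measurable
  finally show ?thesis .
qed

lemma coord_update_in_fiber_shift:
  assumes "x \<in> unit_cube" "t \<in> {0..1}"
  shows "coord_update x k t \<in> fiber_shift A k \<longleftrightarrow> 1 - fiber_length A k x \<le> t"
  using assms by (simp add: fiber_shift_def)

lemma fiber_length_shift_same:
  assumes "x \<in> unit_cube"
  shows "fiber_length (fiber_shift A k) k x = fiber_length A k x"
proof -
  have "{t\<in>{0..1}. coord_update x k t \<in> fiber_shift A k} = {t\<in>{0..1}. 1 - fiber_length A k x \<le> t \<and> t \<le> 1}"
    using coord_update_in_fiber_shift[OF assms] by auto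
  then show ?thesis
    unfolding fiber_length_def[of "fiber_shift A k"]
    using measure_unit_interval_measure_Icc[of "1 - fiber_length A k x" 1] fiber_length_bounds[of A k x] by simp
qed

lemma mean_fiber_length:
  fixes A :: "(real ^ 'n) set"
  assumes "A \<in> sets borel"
  shows "(LINT x|cube_measure. fiber_length A k x) = (LINT x|cube_measure. indicator A x)"
proof -
  have "(LINT x|cube_measure. indicator A x :: real)
      = (LINT x|cube_measure. LINT t|unit_interval_measure. indicator A (coord_update x k t))"
    using assms by (intro integral_cube_resample_coordinate[where K = 1]) (auto simp: indicator_def)
  then show ?thesis using assms by (simp add: fiber_length_eq_integral)
qed

lemma mean_fiber_shift:
  fixes A :: "(real ^ 'n) set"
  assumes "A \<in> sets borel"
  shows "(LINT x|cube_measure. indicator (fiber_shift A k) x :: real) = (LINT x|cube_measure. indicator A x)"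
proof -
  have "(LINT x|cube_measure. fiber_length (fiber_shift A k) k x) = (LINT x|cube_measure. fiber_length A k x)"
    by (intro Bochner_Integration.integral_cong) (auto simp: fiber_length_shift_same)
  then show ?thesis using mean_fiber_length[of _ k] assms fiber_shift_borel by metis
qed

text \<open>A shift in direction \<open>k\<close> makes the fiber lengths in every other direction \<open>j\<close> more unequal. By
Fubini in direction \<open>k\<close> it is enough to look at each plane in the directions \<open>j\<close> and \<open>k\<close>
separately; there the shift is the rearrangement treated above, and the horizontal slices are the
\<open>j\<close>-fibers.\<close>

lemma truncated_mean_fiber_shift:
  fixes A :: "(real ^ 'n) set"
  assumes A: "A \<in> sets borel"
  shows "(LINT x|cube_measure. min (fiber_length (fiber_shift A k) j x) c)
       \<le> (LINT x|cube_measure. min (fiber_length A j x) c)"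
proof (cases "j = k")
  case True
  then have "(LINT x|cube_measure. min (fiber_length (fiber_shift A k) j x) c)
       = (LINT x|cube_measure. min (fiber_length A j x) c)"
    by (intro Bochner_Integration.integral_cong) (auto simp: fiber_length_shift_same)
  then show ?thesis by simp
next
  case False
  let ?U = unit_interval_measure
  interpret C: prob_space "cube_measure :: (real ^ 'n) measure" by (rule prob_space_cube_measure)
  interpret U: prob_space ?U by (rule prob_space_unit_interval_measure)
  interpret CU: pair_prob_space "cube_measure :: (real ^ 'n) measure" ?U ..
  have resample: "(LINT x|cube_measure. min (fiber_length B j x) c)
      = (LINT x|cube_measure. LINT t|?U. min (fiber_length B j (coord_update x k t)) c)"
    and int: "integrable cube_measure (\<lambda>x. LINT t|?U. min (fiber_length B j (coord_update x k t)) c)"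
    if B: "B \<in> sets borel" for B :: "(real ^ 'n) set"
  proof -
    have m: "(\<lambda>x. min (fiber_length B j x) c) \<in> borel_measurable borel"
      using measurable_fiber_length[OF B] by (intro borel_measurable_min) auto
    have b: "\<bar>min (fiber_length B j x) c\<bar> \<le> 1 + \<bar>c\<bar>" for x
      using fiber_length_bounds[of B j x] by (auto simp: min_def abs_if)
    show "(LINT x|cube_measure. min (fiber_length B j x) c)
      = (LINT x|cube_measure. LINT t|?U. min (fiber_length B j (coord_update x k t)) c)"
      using m b by (rule integral_cube_resample_coordinate)
    have "integrable (cube_measure \<Otimes>\<^sub>M ?U) (\<lambda>p. min (fiber_length B j (case p of (x, t) \<Rightarrow> coord_update x k t)) c)"
      using b measurable_compose[OF measurable_coord_update_cube m]
      by (intro CU.P.integrable_const_bound[where B = "1 + \<bar>c\<bar>"]) auto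
    from CU.integrable_fst'[OF this]
    show "integrable cube_measure (\<lambda>x. LINT t|?U. min (fiber_length B j (coord_update x k t)) c)" by simp
  qed
  have plane: "(LINT t|?U. min (fiber_length (fiber_shift A k) j (coord_update x k t)) c)
      \<le> (LINT t|?U. min (fiber_length A j (coord_update x k t)) c)" if x: "x \<in> unit_cube" for x
  proof -
    \<comment> \<open>The slice of \<open>A\<close> by the plane through \<open>x\<close>: direction \<open>j\<close> is the base, direction \<open>k\<close> the height.\<close>
    define Q where "Q = {p \<in> space (?U \<Otimes>\<^sub>M ?U). coord_update (coord_update x j (fst p)) k (snd p) \<in> A}"
    have "(\<lambda>p. coord_update (coord_update x j (fst p)) k (snd p)) \<in> ?U \<Otimes>\<^sub>M ?U \<rightarrow>\<^sub>M borel"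
    proof -
      have "(\<lambda>s. coord_update x j s) \<in> ?U \<rightarrow>\<^sub>M borel"
        by (rule measurable_unit_interval_measure[OF measurable_coord_update_snd])
      then have "(\<lambda>p. (coord_update x j (fst p), snd p)) \<in> ?U \<Otimes>\<^sub>M ?U \<rightarrow>\<^sub>M borel \<Otimes>\<^sub>M borel"
        by (intro measurable_Pair measurable_compose[OF measurable_fst] measurable_compose[OF measurable_snd]
            measurable_unit_interval_measure[of "\<lambda>t. t"]) auto
      from measurable_compose[OF this measurable_coord_update] show ?thesis by simp
    qed
    from measurable_sets[OF this A] have Q: "Q \<in> sets (?U \<Otimes>\<^sub>M ?U)"
      by (simp add: Q_def vimage_def Int_def conj_commute)
    have \<phi>: "measure ?U {t \<in> space ?U. (s, t) \<in> Q} = fiber_length A k (coord_update x j s)" if "s \<in> {0..1}" for s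
      using that by (auto simp: fiber_length_def Q_def space_pair_measure intro!: arg_cong[where f = "measure _"])
    have 1: "measure ?U {s \<in> space ?U. (s, t) \<in> Q} = fiber_length A j (coord_update x k t)" if "t \<in> {0..1}" for t
      using that False
      by (auto simp: fiber_length_def Q_def space_pair_measure coord_update_commute intro!: arg_cong[where f = "measure _"])
    have 2: "measure ?U {s \<in> space ?U. 1 - measure ?U {t \<in> space ?U. (s, t) \<in> Q} \<le> t}
        = fiber_length (fiber_shift A k) j (coord_update x k t)" if t: "t \<in> {0..1}" for t
    proof -
      have "coord_update (coord_update x k t) j s \<in> fiber_shift A k \<longleftrightarrow>
          1 - measure ?U {t \<in> space ?U. (s, t) \<in> Q} \<le> t" if s: "s \<in> {0..1}" for s
        unfolding \<phi>[OF s] coord_update_commute[OF False]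
        using x s t by (intro coord_update_in_fiber_shift) auto
      then show ?thesis unfolding fiber_length_def by (intro arg_cong[where f = "measure _"]) auto
    qed
    have "(LINT t|?U. min (fiber_length (fiber_shift A k) j (coord_update x k t)) c)
       = (LINT t|?U. min (measure ?U {s \<in> space ?U. 1 - measure ?U {t \<in> space ?U. (s, t) \<in> Q} \<le> t}) c)"
      by (rule Bochner_Integration.integral_cong) (use 2 in auto)
    also have "\<dots> \<le> (LINT t|?U. min (measure ?U {s \<in> space ?U. (s, t) \<in> Q}) c)"
      using truncated_mean_rearrangement[OF prob_space_unit_interval_measure Q] .
    also have "\<dots> = (LINT t|?U. min (fiber_length A j (coord_update x k t)) c)"
      by (rule Bochner_Integration.integral_cong) (use 1 in auto)
    finally show ?thesis .
  qed
  show ?thesis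
    unfolding resample[OF A] resample[OF fiber_shift_borel[OF A]]
    by (rule integral_mono[OF int[OF fiber_shift_borel[OF A]] int[OF A]]) (simp add: plane)
qed

section \<open>Increasing sets\<close>

definition increasing_in :: "'n \<Rightarrow> (real ^ 'n) set \<Rightarrow> bool" where
  "increasing_in k A \<longleftrightarrow> (\<forall>x\<in>unit_cube. \<forall>t\<in>{0..1}. x $ k \<le> t \<longrightarrow> x \<in> A \<longrightarrow> coord_update x k t \<in> A)"

lemma increasing_in_fiber_shift_same: "increasing_in k (fiber_shift A k)"
  unfolding increasing_in_def by (auto simp: coord_update_in_fiber_shift fiber_shift_def)

text \<open>This is why one shift per direction suffices. If \<open>A\<close> is increasing in direction \<open>j\<close>, then moving up
along \<open>j\<close> enlarges the \<open>k\<close>-fiber, hence also its length, hence the interval that replaces it.\<close>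

lemma increasing_in_fiber_shift:
  assumes A: "A \<in> sets borel" and inc: "increasing_in j A"
  shows "increasing_in j (fiber_shift A k)"
proof (cases "j = k")
  case True
  then show ?thesis by (simp add: increasing_in_fiber_shift_same)
next
  case False
  interpret U: prob_space unit_interval_measure by (rule prob_space_unit_interval_measure)
  show ?thesis
    unfolding increasing_in_def
  proof (intro ballI impI)
    fix x :: "real ^ 'a" and t :: real
    assume x: "x \<in> unit_cube" and t: "t \<in> {0..1}" "x $ j \<le> t" and mem: "x \<in> fiber_shift A k"
    have "{s\<in>{0..1}. coord_update x k s \<in> A} \<subseteq> {s\<in>{0..1}. coord_update (coord_update x j t) k s \<in> A}"
    proof safe
      fix s :: real assume s: "s \<in> {0..1}" and "coord_update x k s \<in> A"
      then have "coord_update (coord_update x k s) j t \<in> A"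
        using inc x t False unfolding increasing_in_def by (auto simp del: atLeastAtMost_iff)
      then show "coord_update (coord_update x j t) k s \<in> A"
        by (simp add: coord_update_commute[OF False])
    qed
    then have "fiber_length A k x \<le> fiber_length A k (coord_update x j t)"
      unfolding fiber_length_def by (intro U.finite_measure_mono fiber_sets[OF A])
    then show "coord_update x j t \<in> fiber_shift A k"
      using mem x t False by (auto simp: fiber_shift_def)
  qed
qed

text \<open>Pass from \<open>x\<close> to \<open>y\<close> by raising one coordinate at a time.\<close>

lemma upward_closed_if_increasing_in_all:
  fixes A :: "(real ^ 'n) set"
  assumes inc: "\<And>k. increasing_in k A"
    and x: "x \<in> unit_cube" "x \<in> A" and y: "y \<in> unit_cube" and le: "x \<le> y"
  shows "y \<in> A"
proof -
  have "(\<chi> i. if i \<in> S then y $ i else x $ i) \<in> A" for S :: "'n set"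
    using finite[of S]
  proof (induction S)
    case empty
    then show ?case using x by (simp add: vec_nth_inverse)
  next
    case (insert k S)
    let ?z = "\<chi> i. if i \<in> S then y $ i else x $ i"
    have "?z \<in> unit_cube" using x y by (auto simp: unit_cube_def)
    moreover have "y $ k \<in> {0..1}" using y by (simp add: unit_cube_def)
    moreover have "?z $ k \<le> y $ k" using insert(2) le by (simp add: less_eq_vec_def)
    ultimately have "coord_update ?z k (y $ k) \<in> A"
      using inc[of k] insert.IH unfolding increasing_in_def by blast
    also have "coord_update ?z k (y $ k) = (\<chi> i. if i \<in> insert k S then y $ i else x $ i)"
      by (auto simp: vec_eq_iff)
    finally show ?case .
  qed
  from this[of UNIV] show ?thesis by (simp add: vec_eq_iff)
qed

text \<open>Shift once in each direction, in any order: a shift creates monotonicity in its own direction and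
preserves the monotonicity obtained so far, while the means are constant and the truncated means of
fiber lengths only decrease.\<close>

lemma exists_increasing_rearrangement:
  fixes A :: "(real ^ 'n) set"
  assumes A: "A \<in> sets borel"
  shows "\<exists>B \<in> sets borel. (\<forall>k. increasing_in k B) \<and>
     (LINT x|cube_measure. indicator B x :: real) = (LINT x|cube_measure. indicator A x) \<and>
     (\<forall>k c. (LINT x|cube_measure. min (fiber_length B k x) c) \<le> (LINT x|cube_measure. min (fiber_length A k x) c))"
proof -
  have "\<exists>B \<in> sets borel. (\<forall>k\<in>S. increasing_in k B) \<and>
     (LINT x|cube_measure. indicator B x :: real) = (LINT x|cube_measure. indicator A x) \<and>
     (\<forall>k c. (LINT x|cube_measure. min (fiber_length B k x) c) \<le> (LINT x|cube_measure. min (fiber_length A k x) c))"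
    for S :: "'n set"
    using finite[of S]
  proof (induction S)
    case empty
    then show ?case using A by auto
  next
    case (insert k S)
    then obtain B where B: "B \<in> sets borel" "\<forall>k\<in>S. increasing_in k B"
      "(LINT x|cube_measure. indicator B x :: real) = (LINT x|cube_measure. indicator A x)"
      "\<And>k c. (LINT x|cube_measure. min (fiber_length B k x) c) \<le> (LINT x|cube_measure. min (fiber_length A k x) c)"
      by auto
    show ?case
    proof (intro bexI[of _ "fiber_shift B k"] conjI allI)
      show "fiber_shift B k \<in> sets borel" using B(1) by (rule fiber_shift_borel)
      show "\<forall>j\<in>insert k S. increasing_in j (fiber_shift B k)"
        using B(1,2) increasing_in_fiber_shift increasing_in_fiber_shift_same by blast
      show "(LINT x|cube_measure. indicator (fiber_shift B k) x :: real) = (LINT x|cube_measure. indicator A x)"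
        using mean_fiber_shift[OF B(1)] B(3) by simp
      show "(LINT x|cube_measure. min (fiber_length (fiber_shift B k) j x) c)
          \<le> (LINT x|cube_measure. min (fiber_length A j x) c)" for j c
        using truncated_mean_fiber_shift[OF B(1)] B(4) order_trans by blast
    qed
  qed
  from this[of UNIV] show ?thesis by simp
qed

section \<open>Influences in terms of fiber lengths\<close>

text \<open>Lebesgue measure is the completion of \<open>lborel\<close>. For Borel integrands the two give the same integral,
and the product structure is available only for \<open>lborel\<close>.\<close>

lemma integral_lebesgue_on_eq_lborel:
  fixes F :: "'a :: euclidean_space \<Rightarrow> real"
  assumes S: "S \<in> sets borel" and F: "F \<in> borel_measurable (restrict_space lborel S)"
  shows "(LINT x|lebesgue_on S. F x) = (LINT x|restrict_space lborel S. F x)"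
proof -
  have "(LINT x|lebesgue_on S. F x) = (LINT x|lebesgue. indicator S x *\<^sub>R F x)"
    using S by (intro integral_restrict_space) auto
  also have "\<dots> = (LINT x|lborel. indicator S x *\<^sub>R F x)"
    using S F by (intro integral_completion) (simp add: borel_measurable_restrict_space_iff)
  also have "\<dots> = (LINT x|restrict_space lborel S. F x)"
    using S by (intro integral_restrict_space[symmetric]) auto
  finally show ?thesis .
qed

lemma h_influence_eq_fiber_length:
  fixes A :: "(real ^ 'n) set"
  assumes A: "A \<in> sets borel" and f: "\<And>x. x \<in> unit_cube \<Longrightarrow> f x = indicator A x"
    and h: "concave_on {0..1} h"
  shows "h_influence h f k = (LINT x|cube_measure. h (fiber_length A k x))"
proof -
  have fib: "fiber_expectation f k x = fiber_length A k x" if x: "x \<in> unit_cube" for x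
  proof -
    have "fiber_expectation f k x = (LINT t|lebesgue_on {0..1}. indicator {t\<in>{0..1}. coord_update x k t \<in> A} t)"
      unfolding fiber_expectation_def fiber_def coord_update_def[symmetric]
      using x f by (intro Bochner_Integration.integral_cong) (auto simp: indicator_def)
    also have "\<dots> = (LINT t|unit_interval_measure. indicator {t\<in>{0..1}. coord_update x k t \<in> A} t)"
      unfolding unit_interval_measure_def
      using fiber_sets[OF A, of x k] unfolding unit_interval_measure_def
      by (intro integral_lebesgue_on_eq_lborel borel_measurable_indicator) auto
    also have "\<dots> = fiber_length A k x"
      by (rule integral_indicator_fiber[OF A])
    finally show ?thesis .
  qed
  have "fiber_length A k \<in> borel_measurable cube_measure"
    using measurable_fiber_length[OF A] by (rule measurable_cube_measure)
  then have meas: "(\<lambda>x. h (fiber_length A k x)) \<in> borel_measurable cube_measure"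
    using fiber_length_bounds by (intro borel_measurable_concave_comp[OF h]) auto
  have "h_influence h f k = (LINT x|lebesgue_on unit_cube. h (fiber_length A k x))"
    unfolding h_influence_def cube_expectation_def
    by (intro Bochner_Integration.integral_cong) (auto simp: fib)
  also have "\<dots> = (LINT x|cube_measure. h (fiber_length A k x))"
    using meas unfolding cube_measure_def by (intro integral_lebesgue_on_eq_lborel) auto
  finally show ?thesis .
qed

lemma cube_expectation_eq_indicator:
  fixes A :: "(real ^ 'n) set"
  assumes A: "A \<in> sets borel" and f: "\<And>x. x \<in> unit_cube \<Longrightarrow> f x = indicator A x"
  shows "cube_expectation f = (LINT x|cube_measure. indicator A x)"
proof -
  have "cube_expectation f = (LINT x|lebesgue_on unit_cube. indicator A x)"
    unfolding cube_expectation_def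
    by (intro Bochner_Integration.integral_cong) (auto simp: f)
  also have "\<dots> = (LINT x|cube_measure. indicator A x)"
    unfolding cube_measure_def using A
    by (intro integral_lebesgue_on_eq_lborel measurable_restrict_space1) auto
  finally show ?thesis .
qed

theorem theorem3:
  fixes h :: "real \<Rightarrow> real" and f :: "real ^ 'n \<Rightarrow> real"
  assumes "h \<in> {0..1} \<rightarrow> {0..1}"
    and "concave_on {0..1} h"
    and "f \<in> unit_cube \<rightarrow> {0, 1}"
    and "f \<in> borel_measurable (restrict_space borel unit_cube)"
  shows "\<exists>g :: real ^ 'n \<Rightarrow> real.
           g \<in> unit_cube \<rightarrow> {0, 1} \<and>
           mono_on unit_cube g \<and>
           cube_expectation f = cube_expectation g \<and>
           (\<forall>k. h_influence h f k \<ge> h_influence h g k)"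
proof -
  define A where "A = {x \<in> unit_cube. f x = 1}"
  have "f -` {1} \<inter> space (restrict_space borel unit_cube) \<in> sets (restrict_space borel unit_cube)"
    using assms(4) by (rule measurable_sets) simp
  then have A: "A \<in> sets borel"
    by (simp add: sets_restrict_space_iff space_restrict_space A_def vimage_def Int_def conj_commute)
  have f: "f x = indicator A x" if "x \<in> unit_cube" for x
    using that assms(3) by (auto simp: A_def indicator_def)
  obtain B where B: "B \<in> sets borel" "\<And>k. increasing_in k B"
    "(LINT x|cube_measure. indicator B x :: real) = (LINT x|cube_measure. indicator A x)"
    "\<And>k c. (LINT x|cube_measure. min (fiber_length B k x) c) \<le> (LINT x|cube_measure. min (fiber_length A k x) c)"
    using exists_increasing_rearrangement[OF A] by auto
  let ?g = "indicator B :: real ^ 'n \<Rightarrow> real"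
  show ?thesis
  proof (intro exI[of _ ?g] conjI allI)
    show "?g \<in> unit_cube \<rightarrow> {0, 1}" by (auto simp: indicator_def)
    show "mono_on unit_cube ?g"
    proof (rule mono_onI)
      fix x y :: "real ^ 'n" assume "x \<in> unit_cube" "y \<in> unit_cube" "x \<le> y"
      then have "x \<in> B \<Longrightarrow> y \<in> B" using upward_closed_if_increasing_in_all[OF B(2)] by blast
      then show "?g x \<le> ?g y" by (simp add: indicator_def)
    qed
    show "cube_expectation f = cube_expectation ?g"
      using cube_expectation_eq_indicator[OF A f] cube_expectation_eq_indicator[OF B(1), of ?g] B(3) by simp
    fix k
    have "(LINT x|cube_measure. h (fiber_length B k x)) \<le> (LINT x|cube_measure. h (fiber_length A k x))"
    proof (rule expectation_concave_mono[OF prob_space_cube_measure, where X = "fiber_length A k" and Y = "fiber_length B k" and h = h])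
      show "(LINT x|cube_measure. fiber_length A k x) = (LINT x|cube_measure. fiber_length B k x)"
        using mean_fiber_length[OF A] mean_fiber_length[OF B(1)] B(3) by simp
    qed (use assms(1,2) A B fiber_length_bounds in \<open>auto intro: measurable_cube_measure measurable_fiber_length\<close>)
    then show "h_influence h ?g k \<le> h_influence h f k"
      using h_influence_eq_fiber_length[OF A f assms(2)]
        h_influence_eq_fiber_length[OF B(1) _ assms(2), of ?g] by simp
  qed
qed

end
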